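(* Define, for $n\ge 0$, $$\alpha_n^{(2)}(a,q)=\frac{(a,\,q\sqrt a,\,-q\sqrt a,\,d,\,q/d,\,-a;q)_n}{(\sqrt a,\,-\sqrt a,\,aq/d,\,ad,\,-q,\,q;q)_n}(-1)^n,$$ $$\beta_n^{(2)}(a,q)=\begin{cases}\dfrac{(q^2/(ad),\,dq/a;q^2)_{n/2}}{(adq,\,aq^2/d;q^2)_{n/2}}, & n\text{ even},\\[3mm] -a\,\dfrac{(q/(ad),\,d/a;q^2)_{(n+1)/2}}{(ad,\,aq/d;q^2)_{(n+1)/2}}, & n\text{ odd}.\end{cases}$$ Then $(\alpha_n^{(2)}(a,q),\beta_n^{(2)}(a,q))$ is a WP-Bailey pair with $k=q$, i.e. for every integer $n\ge 0$, $$\beta_n^{(2)}(a,q)=\sum_{j=0}^{n}\frac{(q/a;q)_{n-j}(q;q)_{n+j}}{(q;q)_{n-j}(aq;q)_{n+j}}\,\alpha_j^{(2)}(a,q).$$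
   Context: For an integer $n\ge 0$, $(x;q)_n=\prod_{i=0}^{n-1}(1-xq^i)$ and $(x_1,\dots,x_m;q)_n=\prod_{j=1}^m(x_j;q)_n$ (and likewise with base $q^2$). Here $q,a,d$ are nonzero complex numbers such that none of the denominators vanish, and $\sqrt a$ is a fixed square root of $a$. A pair of sequences $(\alpha_n(a,k),\beta_n(a,k))_{n\ge0}$ is a WP-Bailey pair if $\beta_{n}(a,k) = \sum_{j=0}^{n}\frac{(k/a;q)_{n-j}(k;q)_{n+j}}{(q;q)_{n-j}(aq;q)_{n+j}}\alpha_{j}(a,k)$ for all $n\ge 0$; here the pair is restricted to $k=q$. *)

theory Defs
  imports Complex_Main
begin

definition qpoch :: "complex \<Rightarrow> complex \<Rightarrow> nat \<Rightarrow> complex" where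
  "qpoch x q n = (\<Prod>i<n. 1 - x * q ^ i)"

definition qpochs :: "complex list \<Rightarrow> complex \<Rightarrow> nat \<Rightarrow> complex" where
  "qpochs xs q n = (\<Prod>x\<leftarrow>xs. qpoch x q n)"

definition WP_Bailey_pair ::
  "complex \<Rightarrow> complex \<Rightarrow> complex \<Rightarrow> (nat \<Rightarrow> complex) \<Rightarrow> (nat \<Rightarrow> complex) \<Rightarrow> bool" where
  "WP_Bailey_pair q a k \<alpha> \<beta> \<longleftrightarrow>
     (\<forall>n. \<beta> n = (\<Sum>j=0..n. (qpoch (k / a) q (n - j) * qpoch k q (n + j)) /
                          (qpoch q q (n - j) * qpoch (a * q) q (n + j)) * \<alpha> j))"

text \<open>The argument \<open>s\<close> stands for the chosen square root of \<open>a\<close>.\<close>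

definition alpha2 ::
  "complex \<Rightarrow> complex \<Rightarrow> complex \<Rightarrow> complex \<Rightarrow> nat \<Rightarrow> complex" where
  "alpha2 q a s d n =
     qpochs [a, q * s, - q * s, d, q / d, - a] q n /
     qpochs [s, - s, a * q / d, a * d, - q, q] q n * (- 1) ^ n"

definition beta2 :: "complex \<Rightarrow> complex \<Rightarrow> complex \<Rightarrow> nat \<Rightarrow> complex" where
  "beta2 q a d n =
     (if even n then
        qpochs [q\<^sup>2 / (a * d), d * q / a] (q\<^sup>2) (n div 2) /
        qpochs [a * d * q, a * q\<^sup>2 / d] (q\<^sup>2) (n div 2)
      else
        - a * (qpochs [q / (a * d), d / a] (q\<^sup>2) ((n + 1) div 2) /
               qpochs [a * d, a * q / d] (q\<^sup>2) ((n + 1) div 2)))"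

end

theory Submission
  imports Defs
begin

text \<open>
  Both parity classes of \<open>\<beta>\<close> satisfy the same two-step recurrence
  \<open>D\<^sub>n \<beta>\<^sub>n\<^sub>+\<^sub>2 = R\<^sub>n \<beta>\<^sub>n\<close>, where
  \<open>D\<^sub>n = (1 - adq\<^sup>n\<^sup>+\<^sup>1)(1 - aq\<^sup>n\<^sup>+\<^sup>2/d)\<close> and
  \<open>R\<^sub>n = (1 - q\<^sup>n\<^sup>+\<^sup>2/(ad))(1 - dq\<^sup>n\<^sup>+\<^sup>1/a)\<close>.
  The sums on the right-hand side satisfy it too, because for the summand \<open>F\<close> the combination
  \<open>D\<^sub>n F(n + 2, j) - R\<^sub>n F(n, j)\<close> is a difference \<open>G(n, j + 1) - G(n, j)\<close>
  with a \<open>q\<close>-hypergeometric \<open>G\<close>, as in the Wilf-Zeilberger method.  The cases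
  \<open>n = 0\<close> and \<open>n = 1\<close> then settle everything.
\<close>

section \<open>q-shifted factorials\<close>

lemma qpoch_0 [simp]: "qpoch x q 0 = 1"
  by (simp add: qpoch_def)

lemma qpoch_Suc: "qpoch x q (Suc n) = qpoch x q n * (1 - x * q ^ n)"
  by (simp add: qpoch_def)

lemma qpochs_Nil [simp]: "qpochs [] q n = 1"
  by (simp add: qpochs_def)

lemma qpochs_Cons [simp]: "qpochs (x # xs) q n = qpoch x q n * qpochs xs q n"
  by (simp add: qpochs_def)

text \<open>Both sides are the product of \<open>1 - x * q ^ i\<close> over
  \<open>i \<le> n\<close>.\<close>

lemma qpoch_shift: "qpoch (q * x) q n * (1 - x) = qpoch x q n * (1 - x * q ^ n)"
proof (induction n)
  case (Suc n)
  have "qpoch (q * x) q (Suc n) * (1 - x) = qpoch (q * x) q n * (1 - x) * (1 - q * x * q ^ n)"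
    by (simp add: qpoch_Suc)
  also have "\<dots> = qpoch x q (Suc n) * (1 - x * q ^ Suc n)"
    unfolding Suc.IH by (simp add: qpoch_Suc ac_simps)
  finally show ?case .
qed simp

section \<open>Summand, antidifference and the polynomial identities behind them\<close>

text \<open>This is \<open>alpha2\<close> without its very-well-poised factors, hence free of the
  square root \<open>s\<close>.\<close>

definition wp_coeff :: "complex \<Rightarrow> complex \<Rightarrow> complex \<Rightarrow> nat \<Rightarrow> complex" where
  "wp_coeff q a d j =
     qpochs [a, - a, d, q / d] q j / qpochs [a * q / d, a * d, - q, q] q j * (- 1) ^ j"

text \<open>The summand of the WP-Bailey sum times \<open>1 - a\<close>; this constant is divided
  out only at the very end.\<close>

definition wp_term :: "complex \<Rightarrow> complex \<Rightarrow> complex \<Rightarrow> nat \<Rightarrow> nat \<Rightarrow> complex" where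
  "wp_term q a d n j =
     (qpoch (q / a) q (n - j) * qpoch q q (n + j)) / (qpoch q q (n - j) * qpoch (a * q) q (n + j))
     * (wp_coeff q a d j * (1 - a * q ^ (2 * j)))"

text \<open>
  The antidifference \<open>G(n, m)\<close>, found by Gosper's algorithm; meaningful for \<open>m \<le> n + 1\<close>
  only, where the subtractions on \<open>nat\<close> are not truncated.
\<close>

definition wp_cert :: "complex \<Rightarrow> complex \<Rightarrow> complex \<Rightarrow> nat \<Rightarrow> nat \<Rightarrow> complex" where
  "wp_cert q a d n m =
     q ^ (n + 1 - m) / a * (1 - q ^ (2 * n + 3)) * (1 - a)
     * (qpoch (q / a) q (n + 1 - m) * qpoch q q (n + m))
     / (qpoch q q (n + 2 - m) * qpoch (a * q) q (n + 1 + m))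
     * (wp_coeff q a d m * (1 - q ^ (2 * m)) * (q - a * (d + q / d) * q ^ m + a\<^sup>2 * q ^ (2 * m)))"

text \<open>By \<open>qpoch_shift\<close> the factors with \<open>q * s\<close> and
  \<open>- q * s\<close> over those with \<open>s\<close> and \<open>- s\<close> collapse to two
  linear factors in \<open>q ^ j\<close>, whose product is a difference of squares.\<close>

lemma alpha2_eq_wp_coeff:
  assumes "s\<^sup>2 = a" and nz: "\<And>n. qpochs [s, - s] q n \<noteq> 0"
  shows "alpha2 q a s d j = wp_coeff q a d j * (1 - a * q ^ (2 * j)) / (1 - a)"
proof -
  have s: "1 - s \<noteq> 0" "1 + s \<noteq> 0" using nz[of 1] by (auto simp: qpoch_Suc)
  have a: "1 - a = (1 - s) * (1 + s)" using assms(1) by (simp add: algebra_simps power2_eq_square)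
  have "qpoch (q * s) q j * (1 - s) = qpoch s q j * (1 - s * q ^ j)"
    by (rule qpoch_shift)
  moreover have "qpoch (- (q * s)) q j * (1 + s) = qpoch (- s) q j * (1 + s * q ^ j)"
    using qpoch_shift[of q "- s" j] by simp
  ultimately have *: "qpoch (q * s) q j = qpoch s q j * (1 - s * q ^ j) / (1 - s)"
    "qpoch (- (q * s)) q j = qpoch (- s) q j * (1 + s * q ^ j) / (1 + s)"
    using s by (simp_all add: field_simps)
  have aj: "1 - a * q ^ (2 * j) = (1 - s * q ^ j) * (1 + s * q ^ j)"
    unfolding assms(1)[symmetric] by (simp add: power_even_eq, simp add: algebra_simps power2_eq_square)
  show ?thesis
    using nz[of j] s unfolding alpha2_def wp_coeff_def aj a
    by (simp add: * ac_simps)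
qed

text \<open>The numerator is multiplied out so that \<open>d\<close> enters it only through
  \<open>d + q / d\<close>, as in the polynomial identities.\<close>

lemma wp_coeff_Suc:
  assumes "q \<noteq> 0" "d \<noteq> 0"
  shows "wp_coeff q a d (Suc j) = - wp_coeff q a d j *
     ((1 - a\<^sup>2 * (q ^ j)\<^sup>2) * (1 - (d + q / d) * q ^ j + q * (q ^ j)\<^sup>2))
     / ((1 - a * d * q ^ j) * (1 - a * (q / d) * q ^ j) * (1 - q\<^sup>2 * (q ^ j)\<^sup>2))"
proof -
  have 1: "(1 - a\<^sup>2 * (q ^ j)\<^sup>2) = (1 - a * q ^ j) * (1 + a * q ^ j)"
    by (simp add: algebra_simps power2_eq_square)
  have 2: "1 - (d + q / d) * q ^ j + q * (q ^ j)\<^sup>2 = (1 - d * q ^ j) * (1 - q / d * q ^ j)"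
    using assms by (simp add: field_simps power2_eq_square)
  have 3: "(1 - q\<^sup>2 * (q ^ j)\<^sup>2) = (1 - q * q ^ j) * (1 + q * q ^ j)"
    by (simp add: algebra_simps power2_eq_square)
  show ?thesis
    unfolding wp_coeff_def 1 2 3 by (simp add: qpoch_Suc ac_simps)
qed

text \<open>
  With \<open>J = q\<^sup>j\<close>, \<open>M = q\<^sup>n\<^sup>-\<^sup>j\<close>, \<open>h = q/a\<close> and \<open>u = d + q/d\<close> the telescoping relation
  becomes a polynomial identity without side conditions, linear in \<open>u\<close>.
\<close>

lemma telescoping_identity:
  fixes a h u J M :: "'a :: comm_ring_1"
  defines "q \<equiv> a * h"
  defines "N \<equiv> J * M"
  shows "((1 - a * q * N * u + a\<^sup>2 * q^3 * N\<^sup>2)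
            * ((1 - h * M) * (1 - h * q * M) * (1 - N * q * J) * (1 - N * q\<^sup>2 * J))
          - (1 - h * N * u + h\<^sup>2 * q * N\<^sup>2)
            * ((1 - q * M) * (1 - q\<^sup>2 * M) * (1 - a * N * q * J) * (1 - a * N * q\<^sup>2 * J)))
         * (1 - a * J\<^sup>2)
       = - h * M * (1 - N\<^sup>2 * q^3) * (1 - a)
         * ((1 - a\<^sup>2 * J\<^sup>2) * (1 - u * J + q * J\<^sup>2) * (1 - N * q * J) * (1 - q\<^sup>2 * M)
            + (q - a * u * J + a\<^sup>2 * J\<^sup>2) * (1 - J\<^sup>2) * (1 - h * M) * (1 - a * N * q\<^sup>2 * J))"
  unfolding q_def N_def by (simp add: algebra_simps power2_eq_square power3_eq_cube)

text \<open>The counterpart of the telescoping identity at the upper end, with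
  \<open>J = q ^ (n + 1)\<close>: the summands stem from the terms \<open>j = n + 1\<close> and
  \<open>j = n + 2\<close> and from the antidifference at \<open>n + 1\<close>, in this
  order.\<close>

lemma boundary_identity:
  fixes a h u J :: "'a :: comm_ring_1"
  defines "q \<equiv> a * h"
  shows "(1 - a * u * J + a\<^sup>2 * q * J\<^sup>2) * (1 - h) * (1 - a * J\<^sup>2)
       - (1 - q) * (1 - a\<^sup>2 * J\<^sup>2) * (1 - u * J + q * J\<^sup>2)
       + (1 - a) * (h - u * J + a * J\<^sup>2) * (1 - a * q * J\<^sup>2) = 0"
  unfolding q_def by (simp add: algebra_simps power2_eq_square power3_eq_cube)

section \<open>Telescoping in \<open>j\<close>\<close>

text \<open>Writing \<open>n = j + i\<close> keeps all subtractions genuine. All four terms are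
  polynomial multiples of one quotient \<open>U\<close>, and \<open>telescoping_identity\<close>
  relates the cofactors.\<close>

lemma wp_cert_step:
  assumes "q \<noteq> 0" "a \<noteq> 0" "d \<noteq> 0"
    and aq: "\<And>n. qpoch (a * q) q n \<noteq> 0"
    and qq: "\<And>n. qpoch q q n \<noteq> 0"
    and dn: "\<And>n. qpochs [a * q / d, a * d] q n \<noteq> 0"
    and mq: "\<And>n. qpoch (- q) q n \<noteq> 0"
  shows "(1 - a * d * q * q ^ (j + i)) * (1 - a * q\<^sup>2 / d * q ^ (j + i)) * wp_term q a d (j + i + 2) j
       - (1 - q\<^sup>2 / (a * d) * q ^ (j + i)) * (1 - d * q / a * q ^ (j + i)) * wp_term q a d (j + i) j
       = wp_cert q a d (j + i) (Suc j) - wp_cert q a d (j + i) j"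
proof -
  define h u J M where "h = q / a" and "u = d + q / d" and "J = q ^ j" and "M = q ^ i"
  have q: "q = a * h" using assms by (simp add: h_def)
  define N where "N = J * M"
  have N: "q ^ (j + i) = N" by (simp add: N_def J_def M_def power_add)
  define P Q A B c where "P = qpoch h q i" and "Q = qpoch q q i"
    and "A = qpoch q q (j + i + j)" and "B = qpoch (a * q) q (j + i + j)"
    and "c = wp_coeff q a d j"
  have D: "(1 - a * d * q * N) * (1 - a * q\<^sup>2 / d * N) = 1 - a * q * N * u + a\<^sup>2 * q ^ 3 * N\<^sup>2"
    using assms by (simp add: u_def field_simps power2_eq_square power3_eq_cube)
  have R: "(1 - q\<^sup>2 / (a * d) * N) * (1 - d * q / a * N) = 1 - h * N * u + h\<^sup>2 * q * N\<^sup>2"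
    using assms by (simp add: u_def h_def field_simps power2_eq_square power3_eq_cube)
  have nz: "Q \<noteq> 0" "B \<noteq> 0" "1 - q * M \<noteq> 0" "1 - q\<^sup>2 * M \<noteq> 0"
      "1 - a * N * q * J \<noteq> 0" "1 - a * N * q\<^sup>2 * J \<noteq> 0"
    using qq[of i] qq[of "Suc i"] qq[of "Suc (Suc i)"] aq[of "j + i + j"]
      aq[of "Suc (j + i + j)"] aq[of "Suc (Suc (j + i + j))"]
    by (auto simp: Q_def B_def qpoch_Suc M_def N_def J_def power_add power2_eq_square ac_simps)
  \<comment> \<open>The denominator factors of the coefficient ratio that contain \<open>d\<close>.
    Times \<open>q\<close> they are also the quadratic factor of the antidifference at
    \<open>Suc j\<close>.\<close>
  define E where "E = (1 - a * d * J) * (1 - a * (q / d) * J)"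
  have nz_coeff: "E \<noteq> 0" "1 - q\<^sup>2 * J\<^sup>2 \<noteq> 0"
  proof -
    show "E \<noteq> 0"
      using dn[of "Suc j"] by (auto simp: qpoch_Suc J_def E_def)
    have "1 - q\<^sup>2 * J\<^sup>2 = (1 - q * J) * (1 + q * J)"
      by (simp add: algebra_simps power2_eq_square)
    then show "1 - q\<^sup>2 * J\<^sup>2 \<noteq> 0"
      using qq[of "Suc j"] mq[of "Suc j"] by (auto simp: qpoch_Suc J_def)
  qed
  \<comment> \<open>Numerators as for \<open>n\<close>, denominators as for \<open>n + 2\<close>, so
    that every term below is \<open>U\<close> times a polynomial.\<close>
  define U where "U = P * A * c / (Q * (1 - q * M) * (1 - q\<^sup>2 * M) * B * (1 - a * N * q * J) * (1 - a * N * q\<^sup>2 * J))"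
  have pw: "q ^ (2 * j) = J\<^sup>2" "q ^ (2 * Suc j) = q\<^sup>2 * J\<^sup>2" "q ^ (2 * (j + i) + 3) = N\<^sup>2 * q ^ 3"
    by (simp_all only: J_def power_even_eq power_Suc power_mult_distrib power_add[of q _ 3] N)
  have T2: "wp_term q a d (j + i + 2) j
      = U * ((1 - h * M) * (1 - h * q * M) * (1 - N * q * J) * (1 - N * q\<^sup>2 * J)) * (1 - a * J\<^sup>2)"
  proof -
    have "j + i + 2 - j = Suc (Suc i)" "j + i + 2 + j = Suc (Suc (j + i + j))" by auto
    then have "wp_term q a d (j + i + 2) j
       = (P * (1 - h * M) * (1 - h * (q * M)) * (A * (1 - q * (N * J)) * (1 - q * (q * (N * J)))))
         / (Q * (1 - q * M) * (1 - q * (q * M)) * (B * (1 - a * q * (N * J)) * (1 - a * q * (q * (N * J)))))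
         * (c * (1 - a * J\<^sup>2))"
      unfolding wp_term_def pw
      by (simp only: qpoch_Suc P_def A_def Q_def B_def c_def M_def N_def J_def h_def power_add power_Suc ac_simps)
    also have "\<dots> = U * ((1 - h * M) * (1 - h * q * M) * (1 - N * q * J) * (1 - N * q\<^sup>2 * J)) * (1 - a * J\<^sup>2)"
      unfolding U_def by (simp add: power2_eq_square ac_simps)
    finally show ?thesis .
  qed
  have T0: "wp_term q a d (j + i) j
      = U * ((1 - q * M) * (1 - q\<^sup>2 * M) * (1 - a * N * q * J) * (1 - a * N * q\<^sup>2 * J)) * (1 - a * J\<^sup>2)"
  proof -
    have "wp_term q a d (j + i) j = P * A / (Q * B) * (c * (1 - a * J\<^sup>2))"
      unfolding wp_term_def pw by (simp add: P_def A_def Q_def B_def c_def h_def)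
    also have "\<dots> = U * ((1 - q * M) * (1 - q\<^sup>2 * M) * (1 - a * N * q * J) * (1 - a * N * q\<^sup>2 * J)) * (1 - a * J\<^sup>2)"
      using nz unfolding U_def by simp
    finally show ?thesis .
  qed
  have G0: "wp_cert q a d (j + i) j = U * (h * M * (1 - N\<^sup>2 * q ^ 3) * (1 - a)
      * ((q - a * u * J + a\<^sup>2 * J\<^sup>2) * (1 - J\<^sup>2) * (1 - h * M) * (1 - a * N * q\<^sup>2 * J)))"
  proof -
    have "j + i + 1 - j = Suc i" "j + i + 2 - j = Suc (Suc i)" "j + i + 1 + j = Suc (j + i + j)" by auto
    then have "wp_cert q a d (j + i) j = (h * M) * (1 - N\<^sup>2 * q ^ 3) * (1 - a)
       * (P * (1 - h * M) * A) / (Q * (1 - q * M) * (1 - q * (q * M)) * (B * (1 - a * q * (N * J))))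
       * (c * (1 - J\<^sup>2) * (q - a * u * J + a\<^sup>2 * J\<^sup>2))"
      unfolding wp_cert_def pw
      by (simp add: qpoch_Suc P_def A_def Q_def B_def c_def u_def M_def N_def J_def h_def power_add ac_simps)
    also have "\<dots> = U * (h * M * (1 - N\<^sup>2 * q ^ 3) * (1 - a)
      * ((q - a * u * J + a\<^sup>2 * J\<^sup>2) * (1 - J\<^sup>2) * (1 - h * M) * (1 - a * N * q\<^sup>2 * J)))"
      using nz unfolding U_def by (simp add: power2_eq_square ac_simps)
    finally show ?thesis .
  qed
  have G1: "wp_cert q a d (j + i) (Suc j) = - U * (h * M * (1 - N\<^sup>2 * q ^ 3) * (1 - a)
      * ((1 - a\<^sup>2 * J\<^sup>2) * (1 - u * J + q * J\<^sup>2) * (1 - N * q * J) * (1 - q\<^sup>2 * M)))"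
  proof -
    have "j + i + 1 - Suc j = i" "j + i + 2 - Suc j = Suc i"
      "j + i + 1 + Suc j = Suc (Suc (j + i + j))" "j + i + Suc j = Suc (j + i + j)" by auto
    moreover have "q - a * u * q ^ Suc j + a\<^sup>2 * (q\<^sup>2 * J\<^sup>2)
        = q * E"
      using assms by (simp add: u_def J_def E_def field_simps power2_eq_square)
    moreover have "wp_coeff q a d (Suc j) = - c * ((1 - a\<^sup>2 * J\<^sup>2) * (1 - u * J + q * J\<^sup>2))
     / (E * (1 - q\<^sup>2 * J\<^sup>2))"
      using wp_coeff_Suc[of q d a j] assms by (simp add: c_def u_def J_def E_def)
    ultimately have "wp_cert q a d (j + i) (Suc j) = (M / a) * (1 - N\<^sup>2 * q ^ 3) * (1 - a)
       * (P * (A * (1 - q * (N * J)))) / (Q * (1 - q * M) * (B * (1 - a * q * (N * J)) * (1 - a * q * (q * (N * J)))))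
       * (- c * ((1 - a\<^sup>2 * J\<^sup>2) * (1 - u * J + q * J\<^sup>2))
     / (E * (1 - q\<^sup>2 * J\<^sup>2)) * (1 - q\<^sup>2 * J\<^sup>2)
         * (q * E))"
      unfolding wp_cert_def pw u_def[symmetric]
      by (simp only: qpoch_Suc P_def A_def Q_def B_def M_def N_def J_def h_def power_add power_Suc ac_simps)
    \<comment> \<open>Here \<open>E\<close> and \<open>1 - q\<^sup>2 * J\<^sup>2\<close> cancel
      against the coefficient ratio; the leftover \<open>q\<close> turns \<open>M / a\<close> into
      \<open>h * M\<close>.\<close>
    also have "\<dots> = (q / a * M) * (1 - N\<^sup>2 * q ^ 3) * (1 - a)
       * (P * (A * (1 - q * (N * J)))) / (Q * (1 - q * M) * (B * (1 - a * q * (N * J)) * (1 - a * q * (q * (N * J)))))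
       * (- c * ((1 - a\<^sup>2 * J\<^sup>2) * (1 - u * J + q * J\<^sup>2)))"
      using nz_coeff by simp
    also have "\<dots> = - U * (h * M * (1 - N\<^sup>2 * q ^ 3) * (1 - a)
      * ((1 - a\<^sup>2 * J\<^sup>2) * (1 - u * J + q * J\<^sup>2) * (1 - N * q * J) * (1 - q\<^sup>2 * M)))"
      using nz unfolding U_def h_def by (simp add: power2_eq_square ac_simps)
    finally show ?thesis .
  qed
  have "((1 - a * q * N * u + a\<^sup>2 * q^3 * N\<^sup>2)
            * ((1 - h * M) * (1 - h * q * M) * (1 - N * q * J) * (1 - N * q\<^sup>2 * J))
          - (1 - h * N * u + h\<^sup>2 * q * N\<^sup>2)
            * ((1 - q * M) * (1 - q\<^sup>2 * M) * (1 - a * N * q * J) * (1 - a * N * q\<^sup>2 * J)))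
         * (1 - a * J\<^sup>2)
       = - h * M * (1 - N\<^sup>2 * q^3) * (1 - a)
         * ((1 - a\<^sup>2 * J\<^sup>2) * (1 - u * J + q * J\<^sup>2) * (1 - N * q * J) * (1 - q\<^sup>2 * M)
            + (q - a * u * J + a\<^sup>2 * J\<^sup>2) * (1 - J\<^sup>2) * (1 - h * M) * (1 - a * N * q\<^sup>2 * J))"
    using telescoping_identity[of a h J M u] unfolding N_def q[symmetric] .
  \<comment> \<open>Arbitrary variables let the identity be multiplied by \<open>U\<close> without
    expanding the concrete factors.\<close>
  moreover have "D * (U * X * S) - R * (U * Y * S) = - U * (h * M * v * w * Z) - U * (h * M * v * w * W)"
    if "(D * X - R * Y) * S = - h * M * v * w * (Z + W)" for D X R Y S v w Z W :: complex
    using arg_cong[OF that, of "(*) U"] by (simp add: algebra_simps)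
  ultimately show ?thesis
    unfolding N D R T0 T2 G0 G1 by blast
qed

section \<open>Summation over \<open>j\<close> and the upper boundary\<close>

text \<open>The factor \<open>1 - q ^ (2 * m)\<close> vanishes, so the telescoped sum has no lower
  boundary term.\<close>

lemma wp_cert_0: "wp_cert q a d n 0 = 0"
  by (simp add: wp_cert_def)

text \<open>Telescoping by induction on \<open>m\<close>. The bound on \<open>m\<close> ensures
  \<open>j \<le> n\<close> in every step used.\<close>

lemma sum_wp_cert:
  assumes "q \<noteq> 0" "a \<noteq> 0" "d \<noteq> 0"
    and "\<And>n. qpoch (a * q) q n \<noteq> 0"
    and "\<And>n. qpoch q q n \<noteq> 0"
    and "\<And>n. qpochs [a * q / d, a * d] q n \<noteq> 0"
    and "\<And>n. qpoch (- q) q n \<noteq> 0"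
    and "m \<le> n + 1"
  shows "(1 - a * d * q * q ^ n) * (1 - a * q\<^sup>2 / d * q ^ n) * (\<Sum>j<m. wp_term q a d (n + 2) j)
       - (1 - q\<^sup>2 / (a * d) * q ^ n) * (1 - d * q / a * q ^ n) * (\<Sum>j<m. wp_term q a d n j)
       = wp_cert q a d n m"
  using assms(8)
proof (induction m)
  case (Suc m)
  then obtain i where n: "n = m + i" using le_Suc_ex by auto
  have split: "D * (x + y) - R * (z + w) = (D * x - R * z) + (D * y - R * w)"
    for D R x y z w :: complex
    by (simp add: algebra_simps)
  show ?case
    unfolding sum.lessThan_Suc split Suc.IH[OF Suc_leD[OF Suc.prems]]
    unfolding n wp_cert_step[OF assms(1-7), of m i] by simp
qed (simp add: wp_cert_0)

text \<open>The sum for \<open>n + 2\<close> has two terms beyond the telescoped range; they cancel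
  the boundary value of the antidifference.\<close>

lemma wp_cert_boundary:
  assumes "q \<noteq> 0" "a \<noteq> 0" "d \<noteq> 0"
    and aq: "\<And>n. qpoch (a * q) q n \<noteq> 0"
    and qq: "\<And>n. qpoch q q n \<noteq> 0"
    and dn: "\<And>n. qpochs [a * q / d, a * d] q n \<noteq> 0"
    and mq: "\<And>n. qpoch (- q) q n \<noteq> 0"
  shows "(1 - a * d * q * q ^ n) * (1 - a * q\<^sup>2 / d * q ^ n)
           * (wp_term q a d (n + 2) (n + 1) + wp_term q a d (n + 2) (n + 2))
       + wp_cert q a d n (n + 1) = 0"
proof -
  define h u J where "h = q / a" and "u = d + q / d" and "J = q ^ (n + 1)"
  have q: "q = a * h" using assms by (simp add: h_def)
  define A B c where "A = qpoch q q (2 * n + 1)" and "B = qpoch (a * q) q (2 * n + 2)"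
    and "c = wp_coeff q a d (n + 1)"
  \<comment> \<open>This is \<open>D\<^sub>n\<close> rewritten with \<open>J\<close>. It is also a
    denominator of the coefficient ratio from \<open>n + 1\<close> to \<open>n + 2\<close>, which
    explains why it clears the last term.\<close>
  define D where "D = (1 - a * d * J) * (1 - a * (q / d) * J)"
  have D: "(1 - a * d * q * q ^ n) * (1 - a * q\<^sup>2 / d * q ^ n) = D"
    by (simp add: D_def J_def power2_eq_square ac_simps)
  have Du: "D = 1 - a * u * J + a\<^sup>2 * q * J\<^sup>2"
    using assms by (simp add: D_def u_def field_simps power2_eq_square)
  have pw: "q ^ (2 * n + 2) = J\<^sup>2" "q ^ (2 * n + 3) = q * J\<^sup>2"
  proof -
    have "2 * n + 2 = 2 * (n + 1)" "2 * n + 3 = Suc (2 * (n + 1))" by auto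
    then show "q ^ (2 * n + 2) = J\<^sup>2" "q ^ (2 * n + 3) = q * J\<^sup>2"
      by (simp_all only: J_def power_even_eq power_Suc)
  qed
  have idx: "2 * n + 2 = Suc (2 * n + 1)" "2 * n + 3 = Suc (2 * n + 2)" "2 * n + 4 = Suc (2 * n + 3)"
    by auto
  have A2: "qpoch q q (2 * n + 2) = A * (1 - J\<^sup>2)"
    unfolding A_def idx(1) qpoch_Suc using pw by simp
  have A3: "qpoch q q (2 * n + 3) = A * (1 - J\<^sup>2) * (1 - q * J\<^sup>2)"
    unfolding idx(2) qpoch_Suc A2 using pw by simp
  have A4: "qpoch q q (2 * n + 4) = A * (1 - J\<^sup>2) * (1 - q * J\<^sup>2) * (1 - q\<^sup>2 * J\<^sup>2)"
    unfolding idx(3) qpoch_Suc A3 pw by (simp add: power2_eq_square)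
  have B3: "qpoch (a * q) q (2 * n + 3) = B * (1 - a * q * J\<^sup>2)"
    unfolding idx(2) qpoch_Suc B_def pw by simp
  have B4: "qpoch (a * q) q (2 * n + 4) = B * (1 - a * q * J\<^sup>2) * (1 - a * q\<^sup>2 * J\<^sup>2)"
    unfolding idx(3) qpoch_Suc B3 pw by (simp add: power2_eq_square)
  have nz: "B \<noteq> 0" "1 - a * q * J\<^sup>2 \<noteq> 0" "1 - a * q\<^sup>2 * J\<^sup>2 \<noteq> 0" "1 - q \<noteq> 0"
    using aq[of "2 * n + 4"] qq[of 1] by (auto simp: B4 qpoch_Suc)
  have nz_coeff: "D \<noteq> 0" "1 - q\<^sup>2 * J\<^sup>2 \<noteq> 0"
  proof -
    show "D \<noteq> 0"
      using dn[of "n + 2"] by (auto simp: qpoch_Suc J_def D_def)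
    have "1 - q\<^sup>2 * J\<^sup>2 = (1 - q * J) * (1 + q * J)"
      by (simp add: algebra_simps power2_eq_square)
    then show "1 - q\<^sup>2 * J\<^sup>2 \<noteq> 0"
      using qq[of "n + 2"] mq[of "n + 2"] by (auto simp: qpoch_Suc J_def)
  qed
  \<comment> \<open>The factor common to the three contributions once the term
    \<open>j = n + 2\<close> is multiplied by \<open>D\<close>.\<close>
  define V where "V = c * A * (1 - J\<^sup>2) * (1 - q * J\<^sup>2) / ((1 - q) * B * (1 - a * q * J\<^sup>2))"
  have pJ: "q ^ (2 * (n + 1)) = J\<^sup>2" "q ^ (2 * (n + 2)) = q\<^sup>2 * J\<^sup>2"
  proof -
    have "n + 2 = Suc (n + 1)" by simp
    then show "q ^ (2 * (n + 1)) = J\<^sup>2" "q ^ (2 * (n + 2)) = q\<^sup>2 * J\<^sup>2"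
      by (simp_all only: J_def power_even_eq power_Suc power_mult_distrib)
  qed
  have T1: "wp_term q a d (n + 2) (n + 1) = V * ((1 - h) * (1 - a * J\<^sup>2))"
  proof -
    have "n + 2 - (n + 1) = Suc 0" "n + 2 + (n + 1) = 2 * n + 3" by auto
    then show ?thesis
      unfolding wp_term_def pJ V_def by (simp only: A3 B3 qpoch_Suc) (simp add: h_def c_def ac_simps)
  qed
  have T2: "D * wp_term q a d (n + 2) (n + 2)
      = - V * ((1 - q) * (1 - a\<^sup>2 * J\<^sup>2) * (1 - u * J + q * J\<^sup>2))"
  proof -
    have "wp_coeff q a d (n + 2) = - c * ((1 - a\<^sup>2 * J\<^sup>2) * (1 - u * J + q * J\<^sup>2)) / (D * (1 - q\<^sup>2 * J\<^sup>2))"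
      using wp_coeff_Suc[of q d a "n + 1"] assms by (simp add: c_def u_def J_def D_def)
    moreover have "n + 2 - (n + 2) = 0" "n + 2 + (n + 2) = 2 * n + 4" by auto
    ultimately have "D * wp_term q a d (n + 2) (n + 2)
        = D * ((A * (1 - J\<^sup>2) * (1 - q * J\<^sup>2) * (1 - q\<^sup>2 * J\<^sup>2))
        / (B * (1 - a * q * J\<^sup>2) * (1 - a * q\<^sup>2 * J\<^sup>2))
        * (- c * ((1 - a\<^sup>2 * J\<^sup>2) * (1 - u * J + q * J\<^sup>2)) / (D * (1 - q\<^sup>2 * J\<^sup>2))
            * (1 - a * q\<^sup>2 * J\<^sup>2)))"
      unfolding wp_term_def pJ by (simp only: A4 B4 qpoch_0) (simp add: mult.assoc)
    also have "\<dots> = - V * ((1 - q) * (1 - a\<^sup>2 * J\<^sup>2) * (1 - u * J + q * J\<^sup>2))"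
      using nz nz_coeff unfolding V_def by simp
    finally show ?thesis .
  qed
  have G: "wp_cert q a d n (n + 1) = V * ((1 - a) * (h - u * J + a * J\<^sup>2) * (1 - a * q * J\<^sup>2))"
  proof -
    have "n + 1 - (n + 1) = 0" "n + 2 - (n + 1) = Suc 0" "n + (n + 1) = 2 * n + 1"
      "n + 1 + (n + 1) = 2 * n + 2" by auto
    moreover have "q - a * u * J + a\<^sup>2 * J\<^sup>2 = a * (h - u * J + a * J\<^sup>2)"
      by (simp add: q algebra_simps power2_eq_square)
    ultimately have "wp_cert q a d n (n + 1) = 1 / a * (1 - q * J\<^sup>2) * (1 - a)
       * A / ((1 - q) * B) * (c * (1 - J\<^sup>2) * (a * (h - u * J + a * J\<^sup>2)))"
      unfolding wp_cert_def pJ pw u_def[symmetric] A_def B_def c_def J_def[symmetric]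
      by (simp only: qpoch_Suc) simp
    also have "\<dots> = V * ((1 - a) * (h - u * J + a * J\<^sup>2) * (1 - a * q * J\<^sup>2))"
      using nz assms unfolding V_def by simp
    finally show ?thesis .
  qed
  have "(1 - a * u * J + a\<^sup>2 * q * J\<^sup>2) * (1 - h) * (1 - a * J\<^sup>2)
       - (1 - q) * (1 - a\<^sup>2 * J\<^sup>2) * (1 - u * J + q * J\<^sup>2)
       + (1 - a) * (h - u * J + a * J\<^sup>2) * (1 - a * q * J\<^sup>2) = 0"
    using boundary_identity[of a u J h] unfolding q[symmetric] .
  then have "D * (V * ((1 - h) * (1 - a * J\<^sup>2)))
      + - V * ((1 - q) * (1 - a\<^sup>2 * J\<^sup>2) * (1 - u * J + q * J\<^sup>2))
      + V * ((1 - a) * (h - u * J + a * J\<^sup>2) * (1 - a * q * J\<^sup>2)) = 0"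
    unfolding Du[symmetric] by algebra
  then show ?thesis
    unfolding D T1 T2 G distrib_left[of D] .
qed

lemma sum_wp_term_rec:
  assumes "q \<noteq> 0" "a \<noteq> 0" "d \<noteq> 0"
    and "\<And>n. qpoch (a * q) q n \<noteq> 0"
    and "\<And>n. qpoch q q n \<noteq> 0"
    and "\<And>n. qpochs [a * q / d, a * d] q n \<noteq> 0"
    and "\<And>n. qpoch (- q) q n \<noteq> 0"
  shows "(1 - a * d * q * q ^ n) * (1 - a * q\<^sup>2 / d * q ^ n) * (\<Sum>j\<le>n + 2. wp_term q a d (n + 2) j)
       = (1 - q\<^sup>2 / (a * d) * q ^ n) * (1 - d * q / a * q ^ n) * (\<Sum>j\<le>n. wp_term q a d n j)"
proof -
  have "(\<Sum>j\<le>n + 2. wp_term q a d (n + 2) j) = (\<Sum>j<n + 1. wp_term q a d (n + 2) j)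
      + (wp_term q a d (n + 2) (n + 1) + wp_term q a d (n + 2) (n + 2))"
    by (simp add: lessThan_Suc_atMost)
  moreover have "{..n} = {..<n + 1}"
    by (simp add: lessThan_Suc_atMost)
  moreover have "D * (x + b) = z" if "D * x - z = c" "D * b + c = 0" for D x b z c :: complex
    using that by (simp add: algebra_simps add_eq_0_iff)
  ultimately show ?thesis
    \<comment> \<open>\<open>le_refl\<close> selects \<open>m = n + 1\<close>, the full range
      \<open>j \<le> n\<close>.\<close>
    using sum_wp_cert[OF assms le_refl, of n] wp_cert_boundary[OF assms, of n] by metis
qed

section \<open>The recurrence for the closed form\<close>

text \<open>Passing from \<open>n\<close> to \<open>n + 2\<close> appends one factor to each product
  in base \<open>q\<^sup>2\<close>. In terms of \<open>q ^ n\<close> the appended factors are the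
  same for both parities.\<close>

lemma beta2_rec:
  assumes "d \<noteq> 0"
    and "\<And>n. qpochs [a * d * q, a * q\<^sup>2 / d] (q\<^sup>2) n \<noteq> 0"
    and "\<And>n. qpochs [a * d, a * q / d] (q\<^sup>2) n \<noteq> 0"
  shows "(1 - a * d * q * q ^ n) * (1 - a * q\<^sup>2 / d * q ^ n) * beta2 q a d (n + 2)
       = (1 - q\<^sup>2 / (a * d) * q ^ n) * (1 - d * q / a * q ^ n) * beta2 q a d n"
proof (cases "even n")
  case True
  then obtain k where n: "n = 2 * k" by auto
  show ?thesis
    using assms(1) assms(2)[of "Suc k"] unfolding beta2_def n
    by (simp add: qpoch_Suc power_mult)
next
  case False
  then obtain k where n: "n = 2 * k + 1" by (auto elim: oddE)
  have *: "(2 * k + 1 + 2 + 1) div 2 = Suc (Suc k)" "(2 * k + 1 + 1) div 2 = Suc k" by auto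
  have p: "q ^ (2 * k + 1) = q * q ^ (2 * k)" by simp
  show ?thesis
    using assms(1) assms(3)[of "Suc (Suc k)"] unfolding beta2_def n *
    by (simp add: qpoch_Suc p power2_eq_square power_mult power_mult_distrib ac_simps)
qed

section \<open>Initial values and induction\<close>

theorem lemma2:
  fixes q a d s :: complex
  assumes "q \<noteq> 0" and "a \<noteq> 0" and "d \<noteq> 0"
    and "s\<^sup>2 = a"
    and "\<And>n. qpochs [s, - s, a * q / d, a * d, - q, q] q n \<noteq> 0"
    and "\<And>n. qpochs [a * d * q, a * q\<^sup>2 / d] (q\<^sup>2) n \<noteq> 0"
    and "\<And>n. qpochs [a * d, a * q / d] (q\<^sup>2) n \<noteq> 0"
    and "\<And>n. qpoch q q n \<noteq> 0"
    and "\<And>n. qpoch (a * q) q n \<noteq> 0"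
  shows "WP_Bailey_pair q a q (alpha2 q a s d) (beta2 q a d)"
proof -
  have s: "\<And>n. qpochs [s, - s] q n \<noteq> 0" and mq: "\<And>n. qpoch (- q) q n \<noteq> 0"
    and adn: "\<And>n. qpochs [a * q / d, a * d] q n \<noteq> 0"
    using assms(5) by auto
  \<comment> \<open>The denominators with \<open>s\<close> and \<open>- s\<close> at index 1 exclude
    \<open>a = 1\<close>.\<close>
  have "1 - a = (1 - s) * (1 + s)"
    unfolding assms(4)[symmetric] by (simp add: algebra_simps power2_eq_square)
  then have a1: "1 - a \<noteq> 0"
    using s[of 1] by (auto simp: qpoch_Suc)
  have sum_eq: "(\<Sum>j=0..n. (qpoch (q / a) q (n - j) * qpoch q q (n + j)) /
        (qpoch q q (n - j) * qpoch (a * q) q (n + j)) * alpha2 q a s d j)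
      = (\<Sum>j\<le>n. wp_term q a d n j) / (1 - a)" for n
    unfolding sum_divide_distrib atLeast0AtMost
    by (intro sum.cong refl) (simp add: alpha2_eq_wp_coeff[OF assms(4) s] wp_term_def)
  have "beta2 q a d n = (\<Sum>j\<le>n. wp_term q a d n j) / (1 - a)" for n
  proof (induction n rule: nat_less_induct)
    case (1 n)
    consider "n = 0" | "n = 1" | m where "n = m + 2"
      by (metis One_nat_def add_2_eq_Suc' not0_implies_Suc)
    then show ?case
    proof cases
      case 1
      then show ?thesis
        using a1 by (simp add: beta2_def wp_term_def wp_coeff_def)
    next
      case 2
      \<comment> \<open>The start of the odd subsequence has to be computed; \<open>D\<close> is a
        denominator of both \<open>alpha2\<close> and \<open>beta2\<close> at 1.\<close>
      define D u where "D = (1 - a * d) * (1 - a * (q / d))" and "u = d + q / d"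
      have a2: "1 - a\<^sup>2 = (1 + a) * (1 - a)" and q2_eq: "1 - q\<^sup>2 = (1 + q) * (1 - q)"
        by (simp_all add: algebra_simps power2_eq_square)
      have nz: "1 - q \<noteq> 0" "1 + q \<noteq> 0" "1 - a * q \<noteq> 0" "1 - a * q\<^sup>2 \<noteq> 0" "D \<noteq> 0"
        using assms(8)[of 1] mq[of 1] assms(9)[of 2] adn[of 1]
        by (auto simp: qpoch_Suc numeral_2_eq_2 D_def mult.assoc)
      then have q2: "1 - q\<^sup>2 \<noteq> 0"
        unfolding q2_eq by simp
      have c1: "wp_coeff q a d 1 = - ((1 - a\<^sup>2) * (1 - (d + q / d) + q) / (D * (1 - q\<^sup>2)))"
        using wp_coeff_Suc[of q d a 0] assms(1,3) by (simp add: wp_coeff_def[of _ _ _ 0] D_def)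
      have "(\<Sum>j\<le>1. wp_term q a d 1 j) = (1 - q / a) / (1 - a * q) * (1 - a)
          + (1 - q) * (1 - q\<^sup>2) / ((1 - a * q) * (1 - a * q\<^sup>2)) * (wp_coeff q a d 1 * (1 - a * q\<^sup>2))"
      proof -
        have "qpoch x q (Suc 0) = 1 - x" "qpoch x q (Suc (Suc 0)) = (1 - x) * (1 - x * q)" for x
          by (simp_all add: qpoch_Suc)
        note this [simp]
        have "wp_coeff q a d 0 = 1"
          by (simp add: wp_coeff_def)
        then have "wp_term q a d 1 0 = (1 - q / a) / (1 - a * q) * (1 - a)"
          using nz by (simp add: wp_term_def)
        moreover have "wp_term q a d 1 1 = (1 - q) * (1 - q\<^sup>2) / ((1 - a * q) * (1 - a * q\<^sup>2))
            * (wp_coeff q a d 1 * (1 - a * q\<^sup>2))"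
          by (simp add: wp_term_def power2_eq_square mult.assoc)
        ultimately show ?thesis
          by simp
      qed
      \<comment> \<open>The factors \<open>1 - q\<^sup>2\<close> and
        \<open>1 - a * q\<^sup>2\<close> cancel, and \<open>1 - a\<^sup>2\<close> supplies the
        common factor \<open>1 - a\<close>.\<close>
      also have "\<dots> = ((1 - q / a) * D - (1 - q) * (1 + a) * (1 - u + q)) / ((1 - a * q) * D) * (1 - a)"
      proof -
        have "(1 - q) * (1 - q\<^sup>2) / ((1 - a * q) * (1 - a * q\<^sup>2)) * (wp_coeff q a d 1 * (1 - a * q\<^sup>2))
            = - ((1 - q) * (1 + a) * (1 - u + q)) / ((1 - a * q) * D) * (1 - a)"
          unfolding c1 u_def[symmetric] using nz q2 by (simp add: a2)
        moreover have "(1 - q / a) / (1 - a * q) * (1 - a) = (1 - q / a) * D / ((1 - a * q) * D) * (1 - a)"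
          using nz by simp
        moreover have "x / z * w + - y / z * w = (x - y) / z * w" for x y z w :: complex
          by (simp add: diff_divide_distrib ring_distribs)
        ultimately show ?thesis
          by (simp only:)
      qed
      \<comment> \<open>The numerator splits off \<open>1 - a * q\<close>, which cancels below and
        leaves \<open>beta2\<close> at 1. With \<open>h = q / a\<close> and \<open>u\<close> this is
        a polynomial identity.\<close>
      also have "(1 - q / a) * D - (1 - q) * (1 + a) * (1 - u + q)
          = - a * ((1 - q / (a * d)) * (1 - d / a)) * (1 - a * q)"
      proof -
        define h where "h = q / a"
        have q: "q = a * h" using assms(2) by (simp add: h_def)
        have "D = 1 - a * u + a\<^sup>2 * q"
          using assms(3) by (simp add: D_def u_def field_simps power2_eq_square)
        moreover have "a * ((1 - q / (a * d)) * (1 - d / a)) = a - u + h"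
          using assms(2,3) by (simp add: h_def u_def field_simps)
        moreover have "(1 - h) * (1 - a * u + a\<^sup>2 * q) - (1 - q) * (1 + a) * (1 - u + q)
            = - (a - u + h) * (1 - a * q)"
          unfolding q by (simp add: algebra_simps power2_eq_square)
        ultimately show ?thesis
          by (simp add: h_def)
      qed
      also have "\<dots> / ((1 - a * q) * D) = beta2 q a d 1"
        using nz by (simp add: beta2_def qpoch_Suc D_def)
      finally show ?thesis
        using a1 2 by simp
    next
      case (3 m)
      \<comment> \<open>These are the factors of index \<open>m + 1\<close> in the denominators of
        \<open>alpha2\<close>, so \<open>D\<^sub>m\<close> can be cancelled from both
        recurrences.\<close>
      have "(1 - a * d * q * q ^ m) * (1 - a * q\<^sup>2 / d * q ^ m) \<noteq> 0"
        using adn[of "m + 2"] by (auto simp: qpoch_Suc power2_eq_square ac_simps)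
      moreover have "beta2 q a d m = (\<Sum>j\<le>m. wp_term q a d m j) / (1 - a)"
        using 1 3 by simp
      moreover have "x = y / w" if "C * x = E * b" "C * y = E * z" "C \<noteq> 0" "b = z / w"
        for C E b w x y z :: complex
      proof -
        have "C * x = C * (y / w)"
          using that by simp
        then show ?thesis
          using that(3) by (simp only: mult_cancel_left simp_thms)
      qed
      ultimately show ?thesis
        using beta2_rec[OF assms(3,6,7), of m] sum_wp_term_rec[OF assms(1-3,9,8) adn mq, of m]
        unfolding 3 by blast
    qed
  qed
  then show ?thesis
    unfolding WP_Bailey_pair_def sum_eq by blast
qed

end
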